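(* Let $\mathbf{W}=(W_j)_{j\in[p]}$ be a knockoff statistic such that the null statistics $\{W_j\}_{j\in\mathcal{S}^c}$ are independent and follow the same distribution $\mathbb{P}_0$, and suppose $|\mathcal{S}^c|\ge 2$. Then for any $B\ge 1$ and any $\alpha\in(0,1)$, the output $\widehat{\mathcal{S}}_{AKO+BY}$ of the aggregation of multiple knockoffs (AKO) procedure with $B$ knockoff draws and with the Benjamini–Yekutieli (BY) step-up at level $\alpha$ satisfies $$\mathbb{E}\left[\frac{|\widehat{\mathcal{S}}_{AKO+BY}\cap\mathcal{S}^c|}{|\widehat{\mathcal{S}}_{AKO+BY}|\vee 1}\right]\le \kappa\,\alpha,\qquad\text{where } \kappa=\frac{\sqrt{22}-2}{7\sqrt{22}-32}\le 3.24 .$$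
   Context: Notation: $[p]=\{1,\dots,p\}$; $a\vee b=\max(a,b)$. Model. $\mathbf{X}\in\mathbb{R}^{n\times p}$ is a random design matrix with i.i.d. rows distributed as $\mathbf{x}=(x_1,\dots,x_p)\sim P_X$, and $\mathbf{y}=\mathbf{X}\boldsymbol\beta^*+\sigma\boldsymbol\epsilon\in\mathbb{R}^n$, with $\boldsymbol\beta^*\in\mathbb{R}^p$ fixed, $\sigma>0$, and $\boldsymbol\epsilon$ a Gaussian noise vector independent of $\mathbf{X}$. $\mathcal{S}=\{j\in[p]:\beta^*_j\ne0\}$ and $\mathcal{S}^c=\{j\in[p]:\beta_j^*=0\}$. Model-X knockoffs. $\tilde{\mathbf{x}}=(\tilde x_1,\dots,\tilde x_p)$ are knockoffs of $\mathbf{x}$ if (1) for every $\mathcal{K}\subset[p]$, $(\mathbf{x},\tilde{\mathbf{x}})_{\mathrm{swap}(\mathcal{K})}$ has the same distribution as $(\mathbf{x},\tilde{\mathbf{x}})$, where the swap exchanges the entries $x_j$ and $\tilde x_j$ for all $j\in\mathcal{K}$; (2) $\tilde{\mathbf{x}}$ is independent of the response conditionally on $\mathbf{x}$. A knockoff matrix $\tilde{\mathbf{X}}\in\mathbb{R}^{n\times p}$ is sampled row by row: the rows of $[\mathbf{X},\tilde{\mathbf{X}}]$ are i.i.d., each distributed as $(\mathbf{x},\tilde{\mathbf{x}})$ with property (1), and $\tilde{\mathbf{X}}$ is independent of $\mathbf{y}$ conditionally on $\mathbf{X}$. Knockoff statistic. $\mathbf{W}=(W_j)_{j\in[p]}=f(\mathbf{X},\tilde{\mathbf{X}},\mathbf{y})$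 for a (measurable) function $f$ such that swapping original and knockoff columns switches signs: for every $\mathcal{K}\subset[p]$, $W_j([\mathbf{X},\tilde{\mathbf{X}}]_{\mathrm{swap}(\mathcal{K})},\mathbf{y})$ equals $W_j([\mathbf{X},\tilde{\mathbf{X}}],\mathbf{y})$ if $j\notin\mathcal{K}$ and $-W_j([\mathbf{X},\tilde{\mathbf{X}}],\mathbf{y})$ if $j\in\mathcal{K}$. (A known consequence is that, when the $W_j$, $j\in\mathcal{S}^c$, are i.i.d. with law $\mathbb{P}_0$, $\mathbb{P}_0$ is symmetric around $0$.) Intermediate p-values. For $j\in[p]$, $$\pi_j=\begin{cases}\dfrac{1+\#\{k\in[p]:W_k\le -W_j\}}{p}&\text{if }W_j>0,\\ 1&\text{if }W_j\le0.\end{cases}$$ AKO with BY step-up. Fix $\gamma\in(0,1]$. Draw $B$ knockoff matrices $\tilde{\mathbf{X}}^{(1)},\dots,\tilde{\mathbf{X}}^{(B)}$ for $\mathbf{X}$, all from the same knockoff sampling mechanism; compute $\mathbf{W}^{(b)}=f(\mathbf{X},\tilde{\mathbf{X}}^{(b)},\mathbf{y})$ and the corresponding intermediate p-values $\pi^{(b)}_j$ (so for each $b$, $(\pi_j^{(b)})_{j}$ has the same law as $(\pi_j)_j$). Aggregate: $\bar\pi_j=\min\{1,\,q_\gamma(\{\pi_j^{(b)}:b\in[B]\})/\gamma\}$, where $q_\gamma$ is the empirical $\gamma$-quantile, $q_\gamma(\{a_b: b\in[B]\})=\inf\{x:\frac1B\#\{b:a_b\le x\}\ge\gamma\}$. Order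 $\bar\pi_{(1)}\le\dots\le\bar\pi_{(p)}$ and let $$\widehat k_{BY}=\max\Bigl\{k\in[p]:\bar\pi_{(k)}\le \frac{k\,\beta(p)\,\alpha}{p}\Bigr\},\qquad \beta(p)=\Bigl(\sum_{i=1}^p \frac1i\Bigr)^{-1}.$$ The output is $\widehat{\mathcal{S}}_{AKO+BY}=\{j\in[p]:\bar\pi_j\le\bar\pi_{(\widehat k_{BY})}\}$, and it is empty if no such $k$ exists. *)

theory Defs
  imports "HOL-Probability.Probability" "HOL-Library.Multiset"
begin

section \<open>Model\<close>

definition iid_on :: "'a measure \<Rightarrow> 'b::topological_space measure \<Rightarrow> ('i \<Rightarrow> 'a \<Rightarrow> 'b) \<Rightarrow> 'i set \<Rightarrow> bool" where
  "iid_on M P Z I \<longleftrightarrow>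
     prob_space.indep_vars M (\<lambda>_. borel) Z I \<and> (\<forall>i\<in>I. distr M borel (Z i) = P)"

text \<open>Centred Gaussian vectors, characterised by their one-dimensional projections. The covariance
  matrix is arbitrary and may be degenerate, hence the Dirac case; the standard Gaussian vector is
  the case in which the projection along \<open>u\<close> has standard deviation \<open>norm u\<close>.\<close>

definition gaussian_vector :: "'a measure \<Rightarrow> ('a \<Rightarrow> real^'n) \<Rightarrow> bool" where
  "gaussian_vector M Z \<longleftrightarrow> Z \<in> borel_measurable M \<and>
     (\<forall>u. \<exists>s\<ge>0. distr M borel (\<lambda>\<omega>. u \<bullet> Z \<omega>) =
        (if s = 0 then return borel 0 else density lborel (\<lambda>x. ennreal (normal_density 0 s x))))"

definition cond_indep ::
  "'a measure \<Rightarrow> ('a \<Rightarrow> 'b::topological_space) \<Rightarrow> ('a \<Rightarrow> 'c::topological_space)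
     \<Rightarrow> ('a \<Rightarrow> 'd::topological_space) \<Rightarrow> bool" where
  "cond_indep M U V Z \<longleftrightarrow>
     (let G = vimage_algebra (space M) Z borel;
          cprob = (\<lambda>E. real_cond_exp M G (indicator E))
      in \<forall>A\<in>sets borel. \<forall>B\<in>sets borel. AE \<omega> in M.
           cprob (U -` A \<inter> V -` B \<inter> space M) \<omega> =
           cprob (U -` A \<inter> space M) \<omega> * cprob (V -` B \<inter> space M) \<omega>)"

text \<open>The rows of the design matrix \<open>X \<omega>\<close> are the vectors \<open>X \<omega> $ i\<close>. Independence of \<open>\<epsilon>\<close>
  and \<open>X\<close> is stated through the generated \<open>\<sigma>\<close>-algebras because \<open>prob_space.indep_var\<close> requires
  both variables to have the same type.\<close>

definition linear_model ::
  "'a measure \<Rightarrow> (real^'p) measure \<Rightarrow> ('a \<Rightarrow> real^'p^'n) \<Rightarrow> real^'p \<Rightarrow> real \<Rightarrow> ('a \<Rightarrow> real^'n)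
     \<Rightarrow> ('a \<Rightarrow> real^'n) \<Rightarrow> bool" where
  "linear_model M P\<^sub>X X \<beta> \<sigma> \<epsilon> y \<longleftrightarrow>
     X \<in> borel_measurable M \<and>
     iid_on M P\<^sub>X (\<lambda>i \<omega>. X \<omega> $ i) UNIV \<and>
     \<sigma> > 0 \<and>
     gaussian_vector M \<epsilon> \<and>
     prob_space.indep_set M (sets (vimage_algebra (space M) \<epsilon> borel))
                            (sets (vimage_algebra (space M) X borel)) \<and>
     (\<forall>\<omega>\<in>space M. y \<omega> = X \<omega> *v \<beta> + \<sigma> *\<^sub>R \<epsilon> \<omega>)"

definition nulls :: "real^'p \<Rightarrow> 'p set" where
  "nulls \<beta> = {j. \<beta> $ j = 0}"

section \<open>Model-X knockoffs\<close>

definition swap :: "'p set \<Rightarrow> (real^'p) \<times> (real^'p) \<Rightarrow> (real^'p) \<times> (real^'p)" where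
  "swap K = (\<lambda>(x, x'). (\<chi> j. if j \<in> K then x' $ j else x $ j,
                        \<chi> j. if j \<in> K then x $ j else x' $ j))"

definition swap_cols :: "'p set \<Rightarrow> (real^'p^'n) \<times> (real^'p^'n) \<Rightarrow> (real^'p^'n) \<times> (real^'p^'n)" where
  "swap_cols K = (\<lambda>(X, X'). (\<chi> i. fst (swap K (X $ i, X' $ i)),
                             \<chi> i. snd (swap K (X $ i, X' $ i))))"

text \<open>\<open>Q\<close> is the joint law of a vector with law \<open>P\<^sub>X\<close> and its knockoffs.\<close>

definition knockoff_law :: "(real^'p) measure \<Rightarrow> ((real^'p) \<times> (real^'p)) measure \<Rightarrow> bool" where
  "knockoff_law P\<^sub>X Q \<longleftrightarrow>
     prob_space Q \<and> sets Q = sets borel \<and>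
     distr Q borel fst = P\<^sub>X \<and>
     (\<forall>K. distr Q borel (swap K) = Q)"

text \<open>The law \<open>Q\<close> represents the knockoff sampling mechanism: knockoff matrices sampled from the
  same mechanism share the same \<open>Q\<close>.\<close>

definition knockoff_matrix ::
  "'a measure \<Rightarrow> ((real^'p) \<times> (real^'p)) measure \<Rightarrow> ('a \<Rightarrow> real^'p^'n) \<Rightarrow> ('a \<Rightarrow> real^'n)
     \<Rightarrow> ('a \<Rightarrow> real^'p^'n) \<Rightarrow> bool" where
  "knockoff_matrix M Q X y X' \<longleftrightarrow>
     X' \<in> borel_measurable M \<and>
     iid_on M Q (\<lambda>i \<omega>. (X \<omega> $ i, X' \<omega> $ i)) UNIV \<and>
     cond_indep M X' y X"

definition knockoff_statistic ::
  "((real^'p^'n) \<times> (real^'p^'n) \<Rightarrow> real^'n \<Rightarrow> real^'p) \<Rightarrow> bool" where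
  "knockoff_statistic f \<longleftrightarrow>
     (\<lambda>(XX, y). f XX y) \<in> borel_measurable borel \<and>
     (\<forall>K XX y j. f (swap_cols K XX) y $ j = (if j \<in> K then - (f XX y $ j) else f XX y $ j))"

section \<open>Aggregation of multiple knockoffs with the Benjamini--Yekutieli step-up\<close>

definition intermediate_pval :: "real^'p \<Rightarrow> 'p \<Rightarrow> real" where
  "intermediate_pval W j =
     (if W $ j > 0 then (1 + real (card {k. W $ k \<le> - (W $ j)})) / real CARD('p) else 1)"

definition emp_quantile :: "real \<Rightarrow> nat \<Rightarrow> (nat \<Rightarrow> real) \<Rightarrow> real" where
  "emp_quantile \<gamma> B a = Inf {x. real (card {b \<in> {1..B}. a b \<le> x}) / real B \<ge> \<gamma>}"

definition aggregated_pval :: "real \<Rightarrow> nat \<Rightarrow> (nat \<Rightarrow> 'p \<Rightarrow> real) \<Rightarrow> 'p \<Rightarrow> real" where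
  "aggregated_pval \<gamma> B \<pi> j = min 1 (emp_quantile \<gamma> B (\<lambda>b. \<pi> b j) / \<gamma>)"

text \<open>The \<open>k\<close>-th smallest value of \<open>a\<close>, counted with multiplicity, for \<open>1 \<le> k \<le> CARD('p)\<close>.\<close>

definition order_stat :: "('p::finite \<Rightarrow> real) \<Rightarrow> nat \<Rightarrow> real" where
  "order_stat a k = sorted_list_of_multiset (image_mset a (mset_set UNIV)) ! (k - 1)"

definition BY_factor :: "nat \<Rightarrow> real" where
  "BY_factor p = inverse (\<Sum>i=1..p. 1 / real i)"

definition BY_indices :: "real \<Rightarrow> ('p::finite \<Rightarrow> real) \<Rightarrow> nat set" where
  "BY_indices \<alpha> a =
     {k \<in> {1..CARD('p)}. order_stat a k \<le> real k * BY_factor CARD('p) * \<alpha> / real CARD('p)}"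

definition BY_select :: "real \<Rightarrow> ('p::finite \<Rightarrow> real) \<Rightarrow> 'p set" where
  "BY_select \<alpha> a =
     (if BY_indices \<alpha> a = {} then {} else {j. a j \<le> order_stat a (Max (BY_indices \<alpha> a))})"

text \<open>\<open>W b\<close> is the vector of knockoff statistics of the \<open>b\<close>-th draw, \<open>1 \<le> b \<le> B\<close>.\<close>

definition AKO_BY :: "real \<Rightarrow> real \<Rightarrow> nat \<Rightarrow> (nat \<Rightarrow> real^'p) \<Rightarrow> 'p set" where
  "AKO_BY \<alpha> \<gamma> B W = BY_select \<alpha> (aggregated_pval \<gamma> B (\<lambda>b. intermediate_pval (W b)))"

end

theory Submission imports Defs begin

text \<open>Swapping the original and knockoff columns of any set of nulls preserves the joint law of
  \<open>((X, X'), y)\<close>, because \<open>X \<beta>\<close> does not see these columns. Hence flipping the signs of any set of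
  null statistics preserves the law of \<open>W\<close>, and given their absolute values the null signs are fair
  coins. A null can have a p-value at most \<open>m / p\<close> only if it is positive and precedes the
  \<open>m\<close>-th negative null in the order of decreasing absolute values, so on average there are at most
  \<open>m\<close> such nulls. By Markov's inequality the expected number of nulls with aggregated p-value at
  most \<open>u\<close> is at most \<open>p u\<close>, for every \<open>\<gamma>\<close> and \<open>B\<close>. Summing over the step-up
  thresholds then gives the bound \<open>\<alpha>\<close>, and the constant in the theorem exceeds 1.\<close>

section \<open>Empirical quantiles and the step-up procedure\<close>

text \<open>The infimum in the quantile is attained because the empirical count is a
  right-continuous step function. If the count at \<open>x\<close> were too small, no point below
  the next sample value \<open>z > x\<close> would qualify, forcing the infimum up to
  \<open>z\<close>.\<close>

lemma emp_quantile_leD: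
  assumes B: "B \<ge> 1" and \<gamma>: "\<gamma> \<le> 1" and le: "emp_quantile \<gamma> B a \<le> x"
  shows "real (card {b \<in> {1..B}. a b \<le> x}) / real B \<ge> \<gamma>"
proof (rule ccontr)
  assume neg: "\<not> ?thesis"
  define S where "S = {x. real (card {b \<in> {1..B}. a b \<le> x}) / real B \<ge> \<gamma>}"
  \<comment> \<open>If no sample value exceeded \<open>x\<close>, the fraction at \<open>x\<close>
    would be 1, which is at least \<open>\<gamma>\<close>.\<close>
  have ne: "{b \<in> {1..B}. a b > x} \<noteq> {}"
  proof
    assume "{b \<in> {1..B}. a b > x} = {}"
    hence "{b \<in> {1..B}. a b \<le> x} = {1..B}" by (auto simp: not_less)
    with neg \<gamma> B show False by simp
  qed
  define z where "z = Min (a ` {b \<in> {1..B}. a b > x})"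
  have z: "z > x" unfolding z_def using ne by (subst Min_gr_iff) auto
  have "z \<le> t" if "t \<in> S" for t
  proof (rule ccontr)
    assume "\<not> z \<le> t"
    have "a b \<le> x" if "b \<in> {1..B}" "a b \<le> t" for b
    proof (rule ccontr)
      assume "\<not> a b \<le> x"
      hence "z \<le> a b" unfolding z_def using that by (intro Min_le) auto
      with that \<open>\<not> z \<le> t\<close> show False by simp
    qed
    hence "card {b \<in> {1..B}. a b \<le> t} \<le> card {b \<in> {1..B}. a b \<le> x}"
      by (intro card_mono) auto
    hence "real (card {b \<in> {1..B}. a b \<le> t}) / real B \<le> real (card {b \<in> {1..B}. a b \<le> x}) / real B"
      by (intro divide_right_mono) auto
    with that neg show False unfolding S_def by auto
  qed
  \<comment> \<open>The largest sample value witnesses that \<open>S\<close> is nonempty, as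
    required for a lower bound to pass to \<open>Inf S\<close>.\<close>
  moreover have "Max (a ` {1..B}) \<in> S"
  proof -
    have "{b \<in> {1..B}. a b \<le> Max (a ` {1..B})} = {1..B}" by auto
    thus ?thesis using B \<gamma> unfolding S_def by simp
  qed
  ultimately have "z \<le> Inf S" by (intro cInf_greatest) auto
  with z le show False unfolding emp_quantile_def S_def by simp
qed

text \<open>The first \<open>k\<close> entries of the sorted list survive the filter at the
  \<open>k\<close>-th entry, and ties can only add more. This later guarantees at least
  \<open>k\<close> selections, which controls the denominator of the false discovery
  proportion.\<close>

lemma card_le_order_stat:
  fixes a :: "'p::finite \<Rightarrow> real"
  assumes k: "k \<in> {1..CARD('p)}"
  shows "k \<le> card {j. a j \<le> order_stat a k}"
proof -
  define xs where "xs = sorted_list_of_multiset (image_mset a (mset_set UNIV))"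
  define v where "v = order_stat a k"
  have mset: "mset xs = image_mset a (mset_set UNIV)" unfolding xs_def by simp
  have srt: "sorted xs" unfolding xs_def by simp
  have "length xs = CARD('p)" using arg_cong[OF mset, of size] by simp
  hence len: "k \<le> length xs" using k by simp
  have v: "v = xs ! (k - 1)" unfolding v_def xs_def order_stat_def ..
  have "\<forall>x\<in>set (take k xs). x \<le> v"
  proof
    fix x assume "x \<in> set (take k xs)"
    then obtain i where "i < k" "x = xs ! i" by (auto simp: in_set_conv_nth)
    thus "x \<le> v" using srt len k unfolding v by (auto intro!: sorted_nth_mono)
  qed
  hence "take k xs = filter (\<lambda>x. x \<le> v) (take k xs)" by (simp add: filter_id_conv)
  hence "k \<le> length (filter (\<lambda>x. x \<le> v) xs)"
    using len by (metis append_take_drop_id filter_append length_append length_take le_add1 min_absorb2)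
  also have "\<dots> = size (filter_mset (\<lambda>x. x \<le> v) (mset xs))" by (metis mset_filter size_mset)
  also have "\<dots> = card {j. a j \<le> v}" unfolding mset
    by (simp add: filter_mset_image_mset filter_mset_mset_set comp_def)
  finally show ?thesis unfolding v_def .
qed

text \<open>The weights are chosen so that their tail sums from \<open>k\<close> equal \<open>1 / k\<close>; this replaces the
  random denominator of the false discovery proportion by a deterministic sum over thresholds.\<close>

definition BY_weight :: "nat \<Rightarrow> nat \<Rightarrow> real" where
  "BY_weight p k = (if k < p then 1 / (real k * (real k + 1)) else 1 / real p)"

lemma BY_weight_nonneg: "0 \<le> BY_weight p k"
  unfolding BY_weight_def by simp

text \<open>The terms telescope through \<open>1 / (k * (k + 1)) = 1 / k - 1 / (k + 1)\<close>, and
  the special last weight \<open>1 / p\<close> supplies the remainder. The induction runs downwards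
  from \<open>p\<close>.\<close>

lemma sum_BY_weight:
  assumes "1 \<le> k" "k \<le> p"
  shows "(\<Sum>i=k..p. BY_weight p i) = 1 / real k"
  using assms(2,1)
proof (induction rule: inc_induct)
  case base
  then show ?case by (simp add: BY_weight_def)
next
  case (step n)
  have "(\<Sum>i=n..p. BY_weight p i) = BY_weight p n + (\<Sum>i=Suc n..p. BY_weight p i)"
    using step by (intro sum.atLeast_Suc_atMost) simp
  also have "\<dots> = 1 / (real n * (real n + 1)) + 1 / real (Suc n)"
    using step by (simp add: BY_weight_def)
  also have "\<dots> = 1 / real n" using step by (simp add: divide_simps) (simp add: algebra_simps)
  finally show ?case .
qed

text \<open>This is the source of the harmonic sum that \<open>BY_factor\<close> compensates:
  thresholds linear in \<open>k\<close>, integrated against the weights, give exactly its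
  reciprocal.\<close>

lemma sum_BY_weight_mult:
  assumes "1 \<le> p"
  shows "(\<Sum>k=1..p. BY_weight p k * real k) = (\<Sum>k=1..p. 1 / real k)"
proof -
  obtain q where q: "p = Suc q" using assms by (cases p) auto
  \<comment> \<open>The term at \<open>k = p\<close> equals 1; it stands in for the first harmonic
    term, which the shifted sum misses.\<close>
  have "(\<Sum>k=1..p. BY_weight p k * real k) = (\<Sum>k=1..q. 1 / (real k + 1)) + 1"
    unfolding q by (auto simp: BY_weight_def intro!: sum.cong)
  also have "(\<Sum>k=1..q. 1 / (real k + 1)) = (\<Sum>k=Suc 1..Suc q. 1 / real k)"
    by (subst sum.shift_bounds_cl_Suc_ivl) (simp add: add.commute)
  also have "\<dots> + 1 = (\<Sum>k=1..p. 1 / real k)"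
    unfolding q by (subst (2) sum.atLeast_Suc_atMost) auto
  finally show ?thesis .
qed

text \<open>With \<open>k\<close> the largest BY index, at least \<open>k\<close> coordinates are
  selected, so the denominator can be replaced by \<open>k\<close> and \<open>1 / k\<close> written
  as a tail sum of weights. For \<open>i \<ge> k\<close> every selected coordinate lies below
  \<open>i * c\<close>. The resulting bound is linear in the threshold counts, so expectations can
  be taken count by count under any dependence.\<close>

lemma BY_select_fdp_le:
  fixes a :: "'p::finite \<Rightarrow> real" and N :: "'p set" and \<alpha> :: real
  defines "c \<equiv> BY_factor CARD('p) * \<alpha> / real CARD('p)"
  assumes "0 \<le> \<alpha>"
  shows "real (card (BY_select \<alpha> a \<inter> N)) / real (max (card (BY_select \<alpha> a)) 1)
    \<le> (\<Sum>k=1..CARD('p). BY_weight CARD('p) k * real (card {j\<in>N. a j \<le> real k * c}))"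
proof (cases "BY_indices \<alpha> a = {}")
  case True
  then show ?thesis by (auto simp: BY_select_def intro!: sum_nonneg mult_nonneg_nonneg BY_weight_nonneg)
next
  case False
  define k where "k = Max (BY_indices \<alpha> a)"
  define S where "S = BY_select \<alpha> a"
  have "k \<in> BY_indices \<alpha> a"
    unfolding k_def using False by (intro Max_in) (auto simp: BY_indices_def)
  hence k: "1 \<le> k" "k \<le> CARD('p)" and os: "order_stat a k \<le> real k * c"
    by (auto simp: BY_indices_def c_def mult.assoc)
  have c: "0 \<le> c" unfolding c_def BY_factor_def using assms(2)
    by (intro divide_nonneg_nonneg mult_nonneg_nonneg) (simp_all add: sum_nonneg)
  have S: "S = {j. a j \<le> order_stat a k}" using False unfolding S_def BY_select_def k_def by simp
  have "k \<le> card S" unfolding S using k by (intro card_le_order_stat) auto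
  hence "real (card (S \<inter> N)) / real (max (card S) 1) \<le> real (card (S \<inter> N)) / real k"
    using k by (intro divide_left_mono) auto
  also have "\<dots> = (\<Sum>i=k..CARD('p). BY_weight CARD('p) i * real (card (S \<inter> N)))"
    using sum_BY_weight[OF k] by (simp flip: sum_distrib_right)
  also have "\<dots> \<le> (\<Sum>i=k..CARD('p). BY_weight CARD('p) i * real (card {j\<in>N. a j \<le> real i * c}))"
  proof (intro sum_mono mult_left_mono BY_weight_nonneg, unfold of_nat_le_iff, rule card_mono)
    fix i assume i: "i \<in> {k..CARD('p)}"
    have "a j \<le> real i * c" if "j \<in> S" for j
    proof -
      have "real k * c \<le> real i * c" using i c by (intro mult_right_mono) auto
      with that os show ?thesis unfolding S by auto
    qed
    thus "S \<inter> N \<subseteq> {j\<in>N. a j \<le> real i * c}" by auto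
  qed simp
  also have "\<dots> \<le> (\<Sum>i=1..CARD('p). BY_weight CARD('p) i * real (card {j\<in>N. a j \<le> real i * c}))"
    using k by (intro sum_mono2) (auto intro!: mult_nonneg_nonneg BY_weight_nonneg)
  finally show ?thesis unfolding S_def .
qed

section \<open>Sign flips\<close>

definition flip :: "'p set \<Rightarrow> ('p \<Rightarrow> real) \<Rightarrow> 'p \<Rightarrow> real" where
  "flip K x j = (if j \<in> K then - x j else x j)"

text \<open>These are the positives of \<open>I\<close> preceded by fewer than \<open>m\<close>
  negatives of at least the same size. The inequality is strict because the intermediate p-value
  adds one to its count. Only negatives inside \<open>I\<close> are counted, so with
  \<open>I\<close> the nulls the set is determined by null coordinates.\<close>

definition early_pos :: "'p set \<Rightarrow> nat \<Rightarrow> ('p \<Rightarrow> real) \<Rightarrow> 'p set" where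
  "early_pos I m x = {j\<in>I. x j > 0 \<and> card {k\<in>I. x k \<le> - x j} < m}"

text \<open>Pairs the sign patterns that differ only at \<open>a\<close>, so that the sign of
  \<open>a\<close> can be averaged out.\<close>

lemma sum_Pow_insert:
  assumes "finite J" "a \<notin> J"
  shows "(\<Sum>K\<in>Pow (insert a J). g K) = (\<Sum>K\<in>Pow J. g K + g (insert a K))"
proof -
  have "inj_on (insert a) (Pow J)" using assms by (auto simp: inj_on_def)
  thus ?thesis unfolding Pow_insert using assms
    by (subst sum.union_disjoint) (auto simp: sum.reindex sum.distrib)
qed

text \<open>Reading the signs by decreasing \<open>\<bar>x j\<bar>\<close>, the positives and negatives seen up to the \<open>m\<close>-th
  negative form a fair game. The induction therefore adds the element of least absolute value last.\<close>

lemma sum_early_pos_le_min: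
  assumes "finite I"
  shows "(\<Sum>K\<in>Pow I. card (early_pos I m (flip K x)))
    \<le> (\<Sum>K\<in>Pow I. min m (card {k\<in>I. flip K x k < 0}))"
  using assms
proof (induction I rule: finite_ranking_induct[where f = "\<lambda>j. - \<bar>x j\<bar>"])
  case empty
  then show ?case by (simp add: early_pos_def)
next
  case (insert a J)
  show ?case
  \<comment> \<open>The ranking induction rule does not exclude that the added element is already
    present.\<close>
  proof (cases "a \<in> J")
    case True
    with insert show ?thesis by (simp add: insert_absorb)
  next
    case aJ: False
    define N where "N K = card {k\<in>J. flip K x k < 0}" for K
    have eqJ: "flip (insert a K) x j = flip K x j" if "j \<in> J" for K j
      using that aJ by (auto simp: flip_def)
    \<comment> \<open>Since \<open>a\<close> has the least absolute value, every negative of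
      \<open>J\<close> counts against it when it is positive. For the other elements, adding
      \<open>a\<close> can only increase the number of negatives counted.\<close>
    have sub: "early_pos (insert a J) m y \<subseteq> early_pos J m y \<union> 
        (if y a > 0 \<and> card {k\<in>J. y k < 0} < m then {a} else {})"
      if "\<And>j. j \<in> J \<Longrightarrow> \<bar>y a\<bar> \<le> \<bar>y j\<bar>" for y
    proof
      fix j assume j: "j \<in> early_pos (insert a J) m y"
      show "j \<in> early_pos J m y \<union> (if y a > 0 \<and> card {k\<in>J. y k < 0} < m then {a} else {})"
      proof (cases "j = a")
        case True
        have "card {k\<in>J. y k < 0} \<le> card {k\<in>insert a J. y k \<le> - y a}"
          using insert.hyps(1) that j True by (intro card_mono) (force simp: early_pos_def)+
        thus ?thesis using j True by (auto simp: early_pos_def)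
      next
        case False
        have "card {k\<in>J. y k \<le> - y j} \<le> card {k\<in>insert a J. y k \<le> - y j}"
          using insert.hyps(1) by (intro card_mono) auto
        thus ?thesis using j False by (auto simp: early_pos_def)
      qed
    qed
    have V: "card (early_pos (insert a J) m (flip K x)) \<le> card (early_pos J m (flip K x)) +
        (if flip K x a > 0 \<and> card {k\<in>J. flip K x k < 0} < m then 1 else 0)" for K
    proof -
      have "\<And>j. j \<in> J \<Longrightarrow> \<bar>flip K x a\<bar> \<le> \<bar>flip K x j\<bar>" using insert.hyps(2) by (auto simp: flip_def)
      hence "early_pos (insert a J) m (flip K x) \<subseteq> early_pos J m (flip K x) \<union> 
        (if flip K x a > 0 \<and> card {k\<in>J. flip K x k < 0} < m then {a} else {})"
        by (rule sub)
      hence "card (early_pos (insert a J) m (flip K x)) \<le> card (early_pos J m (flip K x) \<union> 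
        (if flip K x a > 0 \<and> card {k\<in>J. flip K x k < 0} < m then {a} else {}))"
        using insert.hyps(1) by (intro card_mono) (auto simp: early_pos_def)
      also have "\<dots> \<le> card (early_pos J m (flip K x)) +
         card (if flip K x a > 0 \<and> card {k\<in>J. flip K x k < 0} < m then {a} else {})" by (rule card_Un_le)
      finally show ?thesis by (auto split: if_splits)
    qed
    have Neg: "card {k\<in>insert a J. flip K x k < 0} = card {k\<in>J. flip K x k < 0} + (if flip K x a < 0 then 1 else 0)" for K
    proof -
      have "{k\<in>insert a J. flip K x k < 0} = {k\<in>J. flip K x k < 0} \<union> (if flip K x a < 0 then {a} else {})" by auto
      thus ?thesis using aJ insert.hyps(1) by (auto simp: card_insert_if)
    qed
    have eq1: "card {k\<in>J. flip (insert a K) x k < 0} = N K" for K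
      unfolding N_def by (rule arg_cong[of _ _ card]) (auto simp: eqJ)
    have eq2: "early_pos J m (flip (insert a K) x) = early_pos J m (flip K x)" for K
      unfolding early_pos_def by (auto simp: eqJ cong: conj_cong)
    \<comment> \<open>Over the two signs of \<open>a\<close>, only the positive one can gain an
      early positive, and only while fewer than \<open>m\<close> negatives have been seen.\<close>
    have 1: "card (early_pos (insert a J) m (flip K x)) + card (early_pos (insert a J) m (flip (insert a K) x))
      \<le> 2 * card (early_pos J m (flip K x)) + (if x a \<noteq> 0 \<and> N K < m then 1 else 0)" if "K \<in> Pow J" for K
      using V[of K] V[of "insert a K"] that aJ unfolding eq1 eq2 N_def[symmetric]
      by (auto simp: flip_def split: if_splits)
    \<comment> \<open>In exactly the same case the negative sign raises the capped number of
      negatives by one; the two gains balance.\<close>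
    have 2: "min m (card {k\<in>insert a J. flip K x k < 0}) + min m (card {k\<in>insert a J. flip (insert a K) x k < 0})
      = 2 * min m (N K) + (if x a \<noteq> 0 \<and> N K < m then 1 else 0)" if "K \<in> Pow J" for K
      unfolding Neg eq1 N_def[symmetric] using that aJ by (auto simp: flip_def)
    have "(\<Sum>K\<in>Pow (insert a J). card (early_pos (insert a J) m (flip K x)))
      \<le> (\<Sum>K\<in>Pow J. 2 * card (early_pos J m (flip K x)) + (if x a \<noteq> 0 \<and> N K < m then 1 else 0))"
      unfolding sum_Pow_insert[OF insert.hyps(1) aJ] by (intro sum_mono 1)
    also have "\<dots> \<le> (\<Sum>K\<in>Pow J. 2 * min m (N K) + (if x a \<noteq> 0 \<and> N K < m then 1 else 0))"
      using insert.IH unfolding sum.distrib sum_distrib_left[symmetric] N_def by simp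
    also have "\<dots> = (\<Sum>K\<in>Pow (insert a J). min m (card {k\<in>insert a J. flip K x k < 0}))"
      unfolding sum_Pow_insert[OF insert.hyps(1) aJ] by (intro sum.cong refl 2[symmetric])
    finally show ?thesis .
  qed
qed

text \<open>Capping the negatives at \<open>m\<close> bounds every sign pattern by \<open>m\<close>.
  Under uniformly random signs the mean number of early positives is therefore at most
  \<open>m\<close>, whatever the absolute values.\<close>

lemma sum_early_pos_flip_le:
  assumes "finite I"
  shows "(\<Sum>K\<in>Pow I. card (early_pos I m (flip K x))) \<le> m * 2 ^ card I"
proof -
  have "(\<Sum>K\<in>Pow I. card (early_pos I m (flip K x))) \<le> (\<Sum>K\<in>Pow I. min m (card {k\<in>I. flip K x k < 0}))"
    using assms by (rule sum_early_pos_le_min)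
  also have "\<dots> \<le> (\<Sum>K\<in>Pow I. m)" by (intro sum_mono) simp
  finally show ?thesis using assms by (simp add: card_Pow mult.commute)
qed

section \<open>Invariance under swaps of null columns\<close>

lemma borel_measurable_vecI:
  fixes f :: "'a \<Rightarrow> 'b::euclidean_space ^ 'n"
  assumes "\<And>i. (\<lambda>x. f x $ i) \<in> borel_measurable M"
  shows "f \<in> borel_measurable M"
  using assms by (subst borel_measurable_euclidean_space)
    (auto simp: Basis_vec_def inner_axis intro!: borel_measurable_inner)

lemma measurable_matrix_vector_mult [measurable]:
  fixes A :: "'a \<Rightarrow> real^'p^'n" and b :: "real^'p"
  assumes "A \<in> borel_measurable M"
  shows "(\<lambda>x. A x *v b) \<in> borel_measurable M"
proof -
  have "(\<lambda>A::real^'p^'n. A *v b) \<in> borel_measurable borel"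
    unfolding matrix_vector_mult_def by (intro borel_measurable_continuous_onI continuous_intros)
  from measurable_compose[OF assms this] show ?thesis .
qed

lemma measurable_swap [measurable]:
  fixes K :: "'p::finite set"
  shows "swap K \<in> borel_measurable borel"
proof -
  have "(\<lambda>z :: (real^'p) \<times> (real^'p). if j \<in> K then g z $ j else h z $ j) \<in> borel_measurable borel"
    if "continuous_on UNIV g" "continuous_on UNIV h" for g h :: "(real^'p) \<times> (real^'p) \<Rightarrow> real^'p" and j
    using that by (intro borel_measurable_continuous_onI) (cases "j \<in> K"; simp add: continuous_intros)
  from this[of snd fst] this[of fst snd] show ?thesis unfolding swap_def case_prod_unfold
    by (intro borel_measurable_Pair borel_measurable_vecI) (simp_all add: continuous_intros)
qed

lemma measurable_swap_cols [measurable]: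
  fixes K :: "'p::finite set"
  shows "(swap_cols K :: (real^'p^'n) \<times> (real^'p^'n) \<Rightarrow> _) \<in> borel_measurable borel"
proof -
  have nth: "(\<lambda>z :: (real^'p^'n) \<times> (real^'p^'n). (fst z $ i, snd z $ i)) \<in> borel_measurable borel" for i
    by (intro borel_measurable_continuous_onI continuous_intros)
  have sw: "(\<lambda>z :: (real^'p^'n) \<times> (real^'p^'n). swap K (fst z $ i, snd z $ i)) \<in> borel_measurable borel" for i
    using measurable_compose[OF nth measurable_swap] .
  have "fst \<in> borel_measurable (borel :: ((real^'p) \<times> (real^'p)) measure)"
    "snd \<in> borel_measurable (borel :: ((real^'p) \<times> (real^'p)) measure)"
    by (intro borel_measurable_continuous_onI continuous_intros)+
  note comp = this[THEN measurable_compose[OF sw]]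
  show ?thesis unfolding swap_cols_def case_prod_unfold
    by (rule borel_measurable_Pair; rule borel_measurable_vecI; simp add: comp)
qed

section \<open>Joint laws of design, knockoffs and response\<close>

text \<open>Rectangles are closed under intersection and generate the product sigma-algebra, and the
  whole space is a rectangle of finite mass.\<close>

lemma measure_pair_eqI:
  assumes "finite_measure \<mu>"
    and \<mu>: "sets \<mu> = sets (M1 \<Otimes>\<^sub>M M2)" and \<nu>: "sets \<nu> = sets (M1 \<Otimes>\<^sub>M M2)"
    and eq: "\<And>A B. A \<in> sets M1 \<Longrightarrow> B \<in> sets M2 \<Longrightarrow> emeasure \<mu> (A \<times> B) = emeasure \<nu> (A \<times> B)"
  shows "\<mu> = \<nu>"
proof (rule measure_eqI_generator_eq[OF Int_stable_pair_measure_generator[of M1 M2] pair_measure_closed])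
  show "sets \<mu> = sigma_sets (space M1 \<times> space M2) {a \<times> b |a b. a \<in> sets M1 \<and> b \<in> sets M2}"
    "sets \<nu> = sigma_sets (space M1 \<times> space M2) {a \<times> b |a b. a \<in> sets M1 \<and> b \<in> sets M2}"
    using \<mu> \<nu> by (simp_all add: sets_pair_measure)
  show "range (\<lambda>_::nat. space M1 \<times> space M2) \<subseteq> {a \<times> b |a b. a \<in> sets M1 \<and> b \<in> sets M2}" by auto
  show "emeasure \<mu> (space M1 \<times> space M2) \<noteq> \<infinity>"
    using finite_measure.emeasure_finite[OF assms(1)] by simp
qed (use eq in auto)

text \<open>Swapping columns swaps each row pair separately. The swapped rows are again independent
  with law \<open>Q\<close>, so both families of rows have the same product law.\<close>

lemma (in prob_space) distr_rows_swap:
  fixes X X' :: "'a \<Rightarrow> real^'p^'n"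
  assumes [measurable]: "X \<in> borel_measurable M" "X' \<in> borel_measurable M"
    and iid: "iid_on M Q (\<lambda>i \<omega>. (X \<omega> $ i, X' \<omega> $ i)) UNIV"
    and Q: "sets Q = sets borel" "distr Q borel (swap K) = Q"
  shows "distr M borel (\<lambda>\<omega>. swap_cols K (X \<omega>, X' \<omega>)) = distr M borel (\<lambda>\<omega>. (X \<omega>, X' \<omega>))"
proof -
  let ?Z = "\<lambda>i \<omega>. (X \<omega> $ i, X' \<omega> $ i)" and ?P = "\<Pi>\<^sub>M i\<in>(UNIV::'n set). (borel :: ((real^'p) \<times> (real^'p)) measure)"
  \<comment> \<open>Reassembles the two matrices from the family of row pairs, carrying the equality
    of product laws over to the matrices.\<close>
  define \<Psi> :: "('n \<Rightarrow> (real^'p) \<times> (real^'p)) \<Rightarrow> (real^'p^'n) \<times> (real^'p^'n)"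
    where "\<Psi> z = (\<chi> i. fst (z i), \<chi> i. snd (z i))" for z
  have ind: "indep_vars (\<lambda>_. borel) ?Z UNIV" and Z: "distr M borel (?Z i) = Q" for i
    using iid by (auto simp: iid_on_def)
  have rv: "random_variable borel (?Z i)" for i
    using ind by (auto simp: indep_vars_def)
  note [measurable] = rv
  have ind': "indep_vars (\<lambda>_. borel) (\<lambda>i \<omega>. swap K (?Z i \<omega>)) UNIV"
    using ind by (rule indep_vars_compose2) simp
  have Z': "distr M borel (\<lambda>\<omega>. swap K (?Z i \<omega>)) = Q" for i
  proof -
    have "distr M borel (\<lambda>\<omega>. swap K (?Z i \<omega>)) = distr (distr M borel (?Z i)) borel (swap K)"
      by (subst distr_distr) (auto simp: comp_def)
    thus ?thesis unfolding Z Q .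
  qed
  have "distr M ?P (\<lambda>\<omega>. \<lambda>i\<in>UNIV. swap K (?Z i \<omega>)) = (\<Pi>\<^sub>M i\<in>UNIV. Q)"
    using indep_vars_iff_distr_eq_PiM[where I = UNIV and M' = "\<lambda>_. borel" and X = "\<lambda>i \<omega>. swap K (?Z i \<omega>)"] ind'
    unfolding Z' by (simp add: rv)
  moreover have "distr M ?P (\<lambda>\<omega>. \<lambda>i\<in>UNIV. ?Z i \<omega>) = (\<Pi>\<^sub>M i\<in>UNIV. Q)"
    using indep_vars_iff_distr_eq_PiM[where I = UNIV and M' = "\<lambda>_. borel" and X = ?Z] ind unfolding Z by (simp add: rv)
  ultimately have eq: "distr M ?P (\<lambda>\<omega> i. swap K (?Z i \<omega>)) = distr M ?P (\<lambda>\<omega> i. ?Z i \<omega>)"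
    by (simp add: restrict_def)
  have nth: "(\<lambda>z. z i) \<in> borel_measurable ?P" for i
    by simp
  have "fst \<in> borel_measurable (borel :: ((real^'p) \<times> (real^'p)) measure)"
    "snd \<in> borel_measurable (borel :: ((real^'p) \<times> (real^'p)) measure)"
    by (intro borel_measurable_continuous_onI continuous_intros)+
  note comp = this[THEN measurable_compose[OF nth]]
  have \<Psi>: "\<Psi> \<in> borel_measurable ?P"
    unfolding \<Psi>_def by (rule borel_measurable_Pair; rule borel_measurable_vecI; simp add: comp)
  have "distr M borel (\<lambda>\<omega>. \<Psi> (\<lambda>i. swap K (?Z i \<omega>))) = distr M borel (\<lambda>\<omega>. \<Psi> (\<lambda>i. ?Z i \<omega>))"
    using arg_cong[OF eq, of "\<lambda>N. distr N borel \<Psi>"]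
    by (subst (asm) (1 2) distr_distr) (auto simp: comp_def \<Psi> intro!: measurable_PiM_single' measurable_compose[OF rv measurable_swap])
  thus ?thesis by (simp add: \<Psi>_def swap_cols_def)
qed

text \<open>The columns that change are multiplied by coefficients equal to 0.\<close>

lemma mult_vec_swap_cols:
  assumes "K \<subseteq> nulls \<beta>"
  shows "fst (swap_cols K XX) *v \<beta> = fst XX *v \<beta>"
  using assms unfolding swap_cols_def swap_def nulls_def
  by (auto simp: vec_eq_iff matrix_vector_mult_def case_prod_unfold intro!: sum.cong)

text \<open>The noise \<open>e\<close> is assumed independent of \<open>X\<close>, not of the pair
  \<open>(X, X')\<close>. Nevertheless the triple has the same law as if it were: given
  \<open>X\<close>, the response has a kernel determined by \<open>h\<close> and the law of
  \<open>e\<close>, and conditional independence says that \<open>X'\<close> does not alter this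
  kernel.\<close>

lemma (in prob_space) cond_indep_distr:
  fixes X :: "'a \<Rightarrow> 'x::second_countable_topology" and X' :: "'a \<Rightarrow> 'x2::second_countable_topology"
    and e :: "'a \<Rightarrow> 'e::second_countable_topology" and h :: "'x \<Rightarrow> 'e \<Rightarrow> 'y::second_countable_topology"
  assumes X[measurable]: "X \<in> borel_measurable M" and X'[measurable]: "X' \<in> borel_measurable M"
    and e[measurable]: "e \<in> borel_measurable M"
    and h[measurable]: "(\<lambda>(x, e). h x e) \<in> borel_measurable borel"
    and ind: "indep_set (sets (vimage_algebra (space M) e borel)) (sets (vimage_algebra (space M) X borel))"
    and y: "\<And>\<omega>. \<omega> \<in> space M \<Longrightarrow> y \<omega> = h (X \<omega>) (e \<omega>)"
    and ci: "cond_indep M X' y X"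
  shows "distr M borel (\<lambda>\<omega>. ((X \<omega>, X' \<omega>), y \<omega>)) =
    distr (distr M borel (\<lambda>\<omega>. (X \<omega>, X' \<omega>)) \<Otimes>\<^sub>M distr M borel e) borel (\<lambda>(xx, e). (xx, h (fst xx) e))"
proof -
  define G where "G = vimage_algebra (space M) X borel"
  have XG[measurable]: "X \<in> borel_measurable G"
    unfolding G_def by (rule measurable_vimage_algebra1) auto
  have sub: "subalgebra M G"
    unfolding subalgebra_def G_def using X by (auto simp: sets_vimage_algebra2 measurable_sets)
  interpret G: finite_measure_subalgebra M G
    by unfold_locales (rule sub)
  have "(\<lambda>\<omega>. h (X \<omega>) (e \<omega>)) \<in> borel_measurable M"
    using measurable_compose[OF borel_measurable_Pair[OF X e] h] by simp
  hence [measurable]: "y \<in> borel_measurable M"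
    using y by (simp cong: measurable_cong)
  have pr: "prob_space (distr M borel e)" by (rule prob_space_distr) simp
  interpret E: prob_space "distr M borel e" by (rule pr)
  interpret XM: prob_space "distr M borel X" by (rule prob_space_distr) simp
  have hb: "(\<lambda>(x, e). h x e) \<in> borel_measurable (borel \<Otimes>\<^sub>M borel)"
    using h by (simp add: borel_prod)
  \<comment> \<open>Independence of the generated sigma-algebras, read on rectangles, is the product
    form of the joint law.\<close>
  have joint: "distr M (borel \<Otimes>\<^sub>M borel) (\<lambda>\<omega>. (X \<omega>, e \<omega>)) = distr M borel X \<Otimes>\<^sub>M distr M borel e"
  proof (rule measure_pair_eqI[symmetric, where ?M1.0 = borel and ?M2.0 = borel])
    interpret PP: pair_prob_space "distr M borel X" "distr M borel e" ..
    show "finite_measure (distr M borel X \<Otimes>\<^sub>M distr M borel e)" by unfold_locales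
    fix A :: "'x set" and C :: "'e set" assume [measurable]: "A \<in> sets borel" "C \<in> sets borel"
    have "emeasure (distr M (borel \<Otimes>\<^sub>M borel) (\<lambda>\<omega>. (X \<omega>, e \<omega>))) (A \<times> C) =
      emeasure M ((e -` C \<inter> space M) \<inter> (X -` A \<inter> space M))"
      by (subst emeasure_distr) (auto intro!: arg_cong[of _ _ "emeasure M"])
    also have "\<dots> = emeasure M (e -` C \<inter> space M) * emeasure M (X -` A \<inter> space M)"
      unfolding emeasure_eq_measure
      by (subst indep_setD[OF ind]) (auto simp: ennreal_mult in_vimage_algebra)
    also have "\<dots> = emeasure (distr M borel X \<Otimes>\<^sub>M distr M borel e) (A \<times> C)"
      by (subst E.emeasure_pair_measure_Times) (auto simp: emeasure_distr mult.commute)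
    finally show "emeasure (distr M borel X \<Otimes>\<^sub>M distr M borel e) (A \<times> C) =
      emeasure (distr M (borel \<Otimes>\<^sub>M borel) (\<lambda>\<omega>. (X \<omega>, e \<omega>))) (A \<times> C)" ..
  qed (simp_all cong: sets_pair_measure_cong)
  \<comment> \<open>This is the conditional probability of \<open>y \<in> C\<close> given
    \<open>X = x\<close>: by independence, \<open>x\<close> is frozen and only the noise is
    integrated.\<close>
  define g where "g C x = measure (distr M borel e) {u. h x u \<in> C}" for C x
  have hC: "{(x, u). h x u \<in> C} \<in> sets (borel \<Otimes>\<^sub>M borel)" if [measurable]: "C \<in> sets borel" for C
    using measurable_sets[OF hb that] by (simp add: vimage_def case_prod_unfold space_pair_measure)
  have g[measurable]: "g C \<in> borel_measurable borel" if C: "C \<in> sets borel" for C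
    unfolding g_def measure_def
    using E.measurable_emeasure_Pair[of "{(x, u). h x u \<in> C}" borel] hC[OF C]
    by (simp add: vimage_def cong: sets_pair_measure_cong)
  have g01: "0 \<le> g C x" "g C x \<le> 1" for C x
    by (auto simp: g_def)
  have gX[measurable]: "(\<lambda>\<omega>. g C (X \<omega>)) \<in> borel_measurable G" if "C \<in> sets borel" for C
    using measurable_compose[OF XG g[OF that]] .
  have gM[measurable]: "(\<lambda>\<omega>. g C (X \<omega>)) \<in> borel_measurable M" if "C \<in> sets borel" for C
    using measurable_compose[OF X g[OF that]] .
  \<comment> \<open>Every set of \<open>G\<close> is a preimage under \<open>X\<close>, so Fubini on
    the product law verifies the integral identity that characterises the conditional
    probability.\<close>
  have yC: "AE \<omega> in M. real_cond_exp M G (indicator (y -` C \<inter> space M)) \<omega> = g C (X \<omega>)"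
    if C[measurable]: "C \<in> sets borel" for C
  proof (rule G.real_cond_exp_charact)
    fix S assume "S \<in> sets G"
    then obtain A where A[measurable]: "A \<in> sets borel" and S: "S = X -` A \<inter> space M"
      unfolding G_def by (auto simp: sets_vimage_algebra2)
    have "{z. fst z \<in> A \<and> h (fst z) (snd z) \<in> C} = (A \<times> UNIV) \<inter> {(x, u). h x u \<in> C}" by auto
    hence mm: "{z. fst z \<in> A \<and> h (fst z) (snd z) \<in> C} \<in> sets (borel \<Otimes>\<^sub>M borel)"
      using hC[OF C] by (simp add: sets.Int)
    have "ennreal (\<integral>\<omega>\<in>S. indicator (y -` C \<inter> space M) \<omega> \<partial>M) = emeasure M (S \<inter> (y -` C \<inter> space M))"
      unfolding S set_lebesgue_integral_def emeasure_eq_measure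
      by (simp flip: indicator_inter_arith)
    also have "S \<inter> (y -` C \<inter> space M) = (\<lambda>\<omega>. (X \<omega>, e \<omega>)) -` {z. fst z \<in> A \<and> h (fst z) (snd z) \<in> C} \<inter> space M"
      unfolding S using y by auto
    also have "emeasure M \<dots> = emeasure (distr M (borel \<Otimes>\<^sub>M borel) (\<lambda>\<omega>. (X \<omega>, e \<omega>))) {z. fst z \<in> A \<and> h (fst z) (snd z) \<in> C}"
      by (subst emeasure_distr) (auto simp: mm)
    also have "\<dots> = (\<integral>\<^sup>+x. emeasure (distr M borel e) (Pair x -` {z. fst z \<in> A \<and> h (fst z) (snd z) \<in> C}) \<partial>distr M borel X)"
      unfolding joint by (rule E.emeasure_pair_measure_alt) (simp add: mm cong: sets_pair_measure_cong)
    also have "\<dots> = (\<integral>\<^sup>+x. ennreal (indicator A x * g C x) \<partial>distr M borel X)"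
      by (intro nn_integral_cong) (auto simp: g_def indicator_def E.emeasure_eq_measure vimage_def)
    also have "\<dots> = (\<integral>\<^sup>+\<omega>. ennreal (indicator A (X \<omega>) * g C (X \<omega>)) \<partial>M)"
      by (subst nn_integral_distr) auto
    also have "\<dots> = ennreal (\<integral>\<omega>. indicator A (X \<omega>) * g C (X \<omega>) \<partial>M)"
      by (intro nn_integral_eq_integral integrable_const_bound[where B = 1])
         (auto simp: g01 indicator_def)
    also have "(\<integral>\<omega>. indicator A (X \<omega>) * g C (X \<omega>) \<partial>M) = (\<integral>\<omega>\<in>S. g C (X \<omega>) \<partial>M)"
      unfolding set_lebesgue_integral_def S
      by (intro Bochner_Integration.integral_cong) (auto simp: indicator_def)
    finally show "(\<integral>\<omega>\<in>S. indicator (y -` C \<inter> space M) \<omega> \<partial>M) = (\<integral>\<omega>\<in>S. g C (X \<omega>) \<partial>M)"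
      by (subst (asm) ennreal_inj) (auto simp: set_lebesgue_integral_def g01 intro!: Bochner_Integration.integral_nonneg)
  qed (auto simp: C gX intro!: integrable_const_bound[where B = 1] gM simp: g01 integrable_indicator_iff emeasure_eq_measure)
  \<comment> \<open>The conditional factorisation lets \<open>g C (X \<omega>)\<close> replace the
    indicator of \<open>y \<in> C\<close>; factors measurable in \<open>G\<close> move in and out of
    the conditional expectations.\<close>
  have rect: "emeasure M {\<omega>\<in>space M. X \<omega> \<in> A \<and> X' \<omega> \<in> A' \<and> y \<omega> \<in> C} =
      (\<integral>\<^sup>+\<omega>. ennreal (g C (X \<omega>)) * indicator {\<omega>\<in>space M. X \<omega> \<in> A \<and> X' \<omega> \<in> A'} \<omega> \<partial>M)"
    if [measurable]: "A \<in> sets borel" "A' \<in> sets borel" and C[measurable]: "C \<in> sets borel" for A A' C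
  proof -
    let ?A = "indicator (X -` A \<inter> space M) :: 'a \<Rightarrow> real" and ?A' = "indicator (X' -` A' \<inter> space M) :: 'a \<Rightarrow> real"
    let ?C = "indicator (y -` C \<inter> space M) :: 'a \<Rightarrow> real"
    let ?AC = "indicator (X' -` A' \<inter> y -` C \<inter> space M) :: 'a \<Rightarrow> real"
    have Am [measurable]: "?A \<in> borel_measurable G"
      using measurable_sets[OF XG, of A] by (simp add: G_def)
    have [measurable]: "X' -` A' \<inter> y -` C \<inter> space M \<in> sets M" by measurable
    have "AE \<omega> in M. real_cond_exp M G ?AC \<omega> = real_cond_exp M G ?A' \<omega> * real_cond_exp M G ?C \<omega>"
      using ci unfolding cond_indep_def G_def[symmetric] Let_def by simp
    with yC[OF C] have ae: "AE \<omega> in M. ?A \<omega> * real_cond_exp M G ?AC \<omega> = (?A \<omega> * g C (X \<omega>)) * real_cond_exp M G ?A' \<omega>"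
      by eventually_elim simp
    have "(\<integral>\<omega>. ?A \<omega> * ?AC \<omega> \<partial>M) = (\<integral>\<omega>. ?A \<omega> * real_cond_exp M G ?AC \<omega> \<partial>M)"
    proof (rule G.real_cond_exp_intg(2)[OF _ Am, symmetric])
      show "integrable M (\<lambda>\<omega>. ?A \<omega> * ?AC \<omega>)"
        by (intro integrable_const_bound[where B = 1]) (auto simp: indicator_def)
    qed measurable
    also have "\<dots> = (\<integral>\<omega>. (?A \<omega> * g C (X \<omega>)) * real_cond_exp M G ?A' \<omega> \<partial>M)"
      using ae by (intro integral_cong_AE) (auto intro: gM C)
    also have "\<dots> = (\<integral>\<omega>. (?A \<omega> * g C (X \<omega>)) * ?A' \<omega> \<partial>M)"
    proof (rule G.real_cond_exp_intg(2))
      show "integrable M (\<lambda>\<omega>. (?A \<omega> * g C (X \<omega>)) * ?A' \<omega>)"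
        using C by (intro integrable_const_bound[where B = 1]) (auto simp: indicator_def g01 intro!: gM)
      show "(\<lambda>\<omega>. ?A \<omega> * g C (X \<omega>)) \<in> borel_measurable G"
        using Am gX[OF C] by (rule borel_measurable_times)
    qed measurable
    finally have eq: "(\<integral>\<omega>. ?A \<omega> * ?AC \<omega> \<partial>M) = (\<integral>\<omega>. (?A \<omega> * g C (X \<omega>)) * ?A' \<omega> \<partial>M)" .
    have "emeasure M {\<omega>\<in>space M. X \<omega> \<in> A \<and> X' \<omega> \<in> A' \<and> y \<omega> \<in> C} = 
      emeasure M ((X -` A \<inter> space M) \<inter> (X' -` A' \<inter> y -` C \<inter> space M))"
      by (rule arg_cong[of _ _ "emeasure M"]) auto
    also have "\<dots> = ennreal (\<integral>\<omega>. ?A \<omega> * ?AC \<omega> \<partial>M)"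
      unfolding emeasure_eq_measure by (simp flip: indicator_inter_arith)
    also have "\<dots> = (\<integral>\<^sup>+\<omega>. ennreal ((?A \<omega> * g C (X \<omega>)) * ?A' \<omega>) \<partial>M)"
      unfolding eq by (intro nn_integral_eq_integral[symmetric] integrable_const_bound[where B = 1])
         (auto simp: g01 indicator_def intro!: gM C)
    also have "\<dots> = (\<integral>\<^sup>+\<omega>. ennreal (g C (X \<omega>)) * indicator {\<omega>\<in>space M. X \<omega> \<in> A \<and> X' \<omega> \<in> A'} \<omega> \<partial>M)"
      by (intro nn_integral_cong) (auto simp: indicator_def)
    finally show ?thesis .
  qed
  have XX'[measurable]: "(\<lambda>\<omega>. (X \<omega>, X' \<omega>)) \<in> M \<rightarrow>\<^sub>M borel \<Otimes>\<^sub>M borel" by measurable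
  \<comment> \<open>For fixed \<open>C\<close> both sides are measures in \<open>D\<close>, the left
    one finite, so agreement on rectangles extends to all measurable \<open>D\<close>.\<close>
  have half: "emeasure M {\<omega>\<in>space M. (X \<omega>, X' \<omega>) \<in> D \<and> y \<omega> \<in> C} =
      (\<integral>\<^sup>+\<omega>. ennreal (g C (X \<omega>)) * indicator {\<omega>\<in>space M. (X \<omega>, X' \<omega>) \<in> D} \<omega> \<partial>M)"
    if D[measurable]: "D \<in> sets (borel \<Otimes>\<^sub>M borel)" and C[measurable]: "C \<in> sets borel" for D C
  proof -
    define \<mu> where "\<mu> = distr (density M (indicator {\<omega>\<in>space M. y \<omega> \<in> C})) (borel \<Otimes>\<^sub>M borel) (\<lambda>\<omega>. (X \<omega>, X' \<omega>))"
    define \<nu> where "\<nu> = distr (density M (\<lambda>\<omega>. ennreal (g C (X \<omega>)))) (borel \<Otimes>\<^sub>M borel) (\<lambda>\<omega>. (X \<omega>, X' \<omega>))"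
    have \<mu>: "emeasure \<mu> D = emeasure M {\<omega>\<in>space M. (X \<omega>, X' \<omega>) \<in> D \<and> y \<omega> \<in> C}"
      if [measurable]: "D \<in> sets (borel \<Otimes>\<^sub>M borel)" for D
    proof -
      have "emeasure \<mu> D = (\<integral>\<^sup>+\<omega>. indicator {\<omega>\<in>space M. y \<omega> \<in> C} \<omega> * indicator ((\<lambda>\<omega>. (X \<omega>, X' \<omega>)) -` D \<inter> space M) \<omega> \<partial>M)"
        unfolding \<mu>_def by (subst emeasure_distr) (auto simp: emeasure_density)
      also have "\<dots> = (\<integral>\<^sup>+\<omega>. indicator {\<omega>\<in>space M. (X \<omega>, X' \<omega>) \<in> D \<and> y \<omega> \<in> C} \<omega> \<partial>M)"
        by (intro nn_integral_cong) (auto simp: indicator_def)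
      finally show ?thesis by simp
    qed
    have \<nu>: "emeasure \<nu> D = (\<integral>\<^sup>+\<omega>. ennreal (g C (X \<omega>)) * indicator {\<omega>\<in>space M. (X \<omega>, X' \<omega>) \<in> D} \<omega> \<partial>M)"
      if [measurable]: "D \<in> sets (borel \<Otimes>\<^sub>M borel)" for D
    proof -
      have "emeasure \<nu> D = (\<integral>\<^sup>+\<omega>. ennreal (g C (X \<omega>)) * indicator ((\<lambda>\<omega>. (X \<omega>, X' \<omega>)) -` D \<inter> space M) \<omega> \<partial>M)"
        unfolding \<nu>_def by (subst emeasure_distr) (auto simp: emeasure_density gM C)
      also have "\<dots> = (\<integral>\<^sup>+\<omega>. ennreal (g C (X \<omega>)) * indicator {\<omega>\<in>space M. (X \<omega>, X' \<omega>) \<in> D} \<omega> \<partial>M)"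
        by (intro nn_integral_cong) (auto simp: indicator_def)
      finally show ?thesis .
    qed
    have "\<mu> = \<nu>"
    proof (rule measure_pair_eqI[where ?M1.0 = borel and ?M2.0 = borel])
      show "finite_measure \<mu>"
      proof (rule finite_measureI)
        have "space \<mu> = space (borel \<Otimes>\<^sub>M borel)" by (simp add: \<mu>_def)
        thus "emeasure \<mu> (space \<mu>) \<noteq> \<infinity>" by (simp only: \<mu>[OF sets.top]) simp
      qed
      fix A :: "'x set" and A' :: "'x2 set" assume [measurable]: "A \<in> sets borel" "A' \<in> sets borel"
      show "emeasure \<mu> (A \<times> A') = emeasure \<nu> (A \<times> A')"
        by (simp add: \<mu> \<nu> rect C)
    qed (simp_all add: \<mu>_def \<nu>_def)
    thus ?thesis using \<mu>[OF D] \<nu>[OF D] by simp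
  qed
  let ?R = "distr M (borel \<Otimes>\<^sub>M borel) (\<lambda>\<omega>. (X \<omega>, X' \<omega>))"
  let ?F = "\<lambda>(xx :: 'x \<times> 'x2, u). (xx, h (fst xx) u)"
  have Fm: "?F \<in> (?R \<Otimes>\<^sub>M distr M borel e) \<rightarrow>\<^sub>M (borel \<Otimes>\<^sub>M borel) \<Otimes>\<^sub>M borel"
  proof -
    have "(\<lambda>z. (fst (fst z), snd z)) \<in> (?R \<Otimes>\<^sub>M distr M borel e) \<rightarrow>\<^sub>M borel \<Otimes>\<^sub>M borel"
      by measurable
    from measurable_compose[OF this hb] show ?thesis
      unfolding case_prod_unfold by (intro measurable_Pair) auto
  qed
  have "distr M ((borel \<Otimes>\<^sub>M borel) \<Otimes>\<^sub>M borel) (\<lambda>\<omega>. ((X \<omega>, X' \<omega>), y \<omega>)) =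
    distr (?R \<Otimes>\<^sub>M distr M borel e) ((borel \<Otimes>\<^sub>M borel) \<Otimes>\<^sub>M borel) ?F"
  proof (rule measure_pair_eqI[where ?M1.0 = "borel \<Otimes>\<^sub>M borel" and ?M2.0 = borel])
    show "finite_measure (distr M ((borel \<Otimes>\<^sub>M borel) \<Otimes>\<^sub>M borel) (\<lambda>\<omega>. ((X \<omega>, X' \<omega>), y \<omega>)))"
      by (rule finite_measure_distr) measurable
    fix D :: "('x \<times> 'x2) set" and C :: "'y set"
    assume D[measurable]: "D \<in> sets (borel \<Otimes>\<^sub>M borel)" and C[measurable]: "C \<in> sets borel"
    have "emeasure (distr M ((borel \<Otimes>\<^sub>M borel) \<Otimes>\<^sub>M borel) (\<lambda>\<omega>. ((X \<omega>, X' \<omega>), y \<omega>))) (D \<times> C) =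
      emeasure M {\<omega>\<in>space M. (X \<omega>, X' \<omega>) \<in> D \<and> y \<omega> \<in> C}"
      by (subst emeasure_distr) (auto intro!: arg_cong[of _ _ "emeasure M"])
    also have "\<dots> = (\<integral>\<^sup>+\<omega>. ennreal (g C (X \<omega>)) * indicator {\<omega>\<in>space M. (X \<omega>, X' \<omega>) \<in> D} \<omega> \<partial>M)"
      by (rule half) fact+
    also have "\<dots> = (\<integral>\<^sup>+\<omega>. ennreal (g C (fst (X \<omega>, X' \<omega>))) * indicator D (X \<omega>, X' \<omega>) \<partial>M)"
      by (intro nn_integral_cong) (auto simp: indicator_def)
    also have "\<dots> = (\<integral>\<^sup>+xx. ennreal (g C (fst xx)) * indicator D xx \<partial>?R)"
      using g[OF C] by (subst nn_integral_distr) auto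
    \<comment> \<open>The section of the preimage at \<open>xx\<close> has noise measure
      \<open>g C (fst xx)\<close> if \<open>xx \<in> D\<close> and 0 otherwise.\<close>
    also have "\<dots> = (\<integral>\<^sup>+xx. emeasure (distr M borel e) (Pair xx -` (?F -` (D \<times> C) \<inter> space (?R \<Otimes>\<^sub>M distr M borel e))) \<partial>?R)"
      by (intro nn_integral_cong)
         (auto simp: g_def indicator_def E.emeasure_eq_measure vimage_def space_pair_measure)
    also have "\<dots> = emeasure (?R \<Otimes>\<^sub>M distr M borel e) (?F -` (D \<times> C) \<inter> space (?R \<Otimes>\<^sub>M distr M borel e))"
      by (intro E.emeasure_pair_measure_alt[symmetric] measurable_sets[OF Fm]) simp
    also have "\<dots> = emeasure (distr (?R \<Otimes>\<^sub>M distr M borel e) ((borel \<Otimes>\<^sub>M borel) \<Otimes>\<^sub>M borel) ?F) (D \<times> C)"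
      by (rule emeasure_distr[OF Fm, symmetric]) simp
    finally show "emeasure (distr M ((borel \<Otimes>\<^sub>M borel) \<Otimes>\<^sub>M borel) (\<lambda>\<omega>. ((X \<omega>, X' \<omega>), y \<omega>))) (D \<times> C) = 
      emeasure (distr (?R \<Otimes>\<^sub>M distr M borel e) ((borel \<Otimes>\<^sub>M borel) \<Otimes>\<^sub>M borel) ?F) (D \<times> C)" .
  qed simp_all
  thus ?thesis by (simp add: borel_prod)
qed

lemma linear_model_measurable:
  assumes "linear_model M P\<^sub>X X \<beta> \<sigma> \<epsilon> y"
  shows "y \<in> borel_measurable M"
proof -
  have [measurable]: "X \<in> borel_measurable M" "\<epsilon> \<in> borel_measurable M"
    using assms by (auto simp: linear_model_def gaussian_vector_def)
  have "(\<lambda>\<omega>. X \<omega> *v \<beta> + \<sigma> *\<^sub>R \<epsilon> \<omega>) \<in> borel_measurable M"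
    by measurable
  thus ?thesis using assms by (simp add: linear_model_def cong: measurable_cong)
qed

text \<open>In the product representation the response depends on the design only through its
  product with \<open>\<beta>\<close>, which null swaps preserve. Swapping then commutes with
  forming the response, and the claim reduces to the invariance of the law of
  \<open>(X, X')\<close>.\<close>

lemma (in prob_space) distr_knockoff_swap:
  fixes X X' :: "'a \<Rightarrow> real^'p^'n" and y \<epsilon> :: "'a \<Rightarrow> real^'n"
  assumes lin: "linear_model M P\<^sub>X X \<beta> \<sigma> \<epsilon> y" and law: "knockoff_law P\<^sub>X Q"
    and km: "knockoff_matrix M Q X y X'" and K: "K \<subseteq> nulls \<beta>"
  shows "distr M borel (\<lambda>\<omega>. (swap_cols K (X \<omega>, X' \<omega>), y \<omega>)) = distr M borel (\<lambda>\<omega>. ((X \<omega>, X' \<omega>), y \<omega>))"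
proof -
  define h where "h x u = x *v \<beta> + \<sigma> *\<^sub>R u" for x :: "real^'p^'n" and u :: "real^'n"
  have [measurable]: "X \<in> borel_measurable M" "X' \<in> borel_measurable M" "\<epsilon> \<in> borel_measurable M"
    using lin km by (auto simp: linear_model_def knockoff_matrix_def gaussian_vector_def)
  have y: "y \<omega> = h (X \<omega>) (\<epsilon> \<omega>)" if "\<omega> \<in> space M" for \<omega>
    using lin that by (auto simp: linear_model_def h_def)
  have h: "(\<lambda>(x, u). h x u) \<in> borel_measurable borel"
    unfolding h_def case_prod_unfold
    by (intro borel_measurable_add borel_measurable_scaleR measurable_matrix_vector_mult
        borel_measurable_continuous_onI[of fst] borel_measurable_continuous_onI[of snd] continuous_intros) auto
  let ?R = "distr M borel (\<lambda>\<omega>. (X \<omega>, X' \<omega>))" and ?L = "distr M borel \<epsilon>"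
  let ?F = "\<lambda>(xx :: (real^'p^'n) \<times> (real^'p^'n), u). (xx, h (fst xx) u)"
  let ?s = "\<lambda>(xx :: (real^'p^'n) \<times> (real^'p^'n), u :: real^'n). (swap_cols K xx, u)"
  interpret L: prob_space ?L by (rule prob_space_distr) simp
  note [measurable] = linear_model_measurable[OF lin]
  have F: "?F \<in> borel_measurable borel"
  proof -
    have "(\<lambda>z :: ((real^'p^'n) \<times> (real^'p^'n)) \<times> (real^'n). (fst (fst z), snd z)) \<in> borel_measurable borel"
      by (intro borel_measurable_continuous_onI continuous_intros)
    from measurable_compose[OF this h] show ?thesis unfolding case_prod_unfold
      by (intro borel_measurable_Pair) (simp_all add: borel_measurable_continuous_onI continuous_intros)
  qed
  have s: "?s \<in> borel_measurable borel"
  proof -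
    have "fst \<in> borel_measurable (borel :: (((real^'p^'n) \<times> (real^'p^'n)) \<times> (real^'n)) measure)"
      by (intro borel_measurable_continuous_onI continuous_intros)
    from measurable_compose[OF this measurable_swap_cols] show ?thesis unfolding case_prod_unfold
      by (intro borel_measurable_Pair) (simp_all add: borel_measurable_continuous_onI continuous_intros)
  qed
  \<comment> \<open>The product of the two laws carries the Borel sets, so measurability may be
    checked over \<open>borel\<close>.\<close>
  have RL: "measurable (?R \<Otimes>\<^sub>M ?L) N = measurable borel N" for N
    by (rule measurable_cong_sets[OF _ refl], subst sets_pair_measure_cong[of _ borel _ borel])
       (simp_all only: sets_distr borel_prod)
  have joint: "distr M borel (\<lambda>\<omega>. ((X \<omega>, X' \<omega>), y \<omega>)) = distr (?R \<Otimes>\<^sub>M ?L) borel ?F"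
    using lin km by (intro cond_indep_distr h y) (auto simp: linear_model_def knockoff_matrix_def)
  have R: "distr ?R borel (swap_cols K) = ?R"
    using distr_rows_swap[of X X' Q K] km law
    by (subst distr_distr) (auto simp: knockoff_matrix_def knockoff_law_def comp_def)
  have "distr M borel (\<lambda>\<omega>. (swap_cols K (X \<omega>, X' \<omega>), y \<omega>)) =
    distr (distr M borel (\<lambda>\<omega>. ((X \<omega>, X' \<omega>), y \<omega>))) borel ?s"
    by (subst distr_distr) (auto simp: s comp_def)
  also have "\<dots> = distr (?R \<Otimes>\<^sub>M ?L) borel (?s \<circ> ?F)"
    unfolding joint by (rule distr_distr[OF s]) (simp only: RL F)
  also have "?s \<circ> ?F = ?F \<circ> ?s"
    by (simp add: h_def fun_eq_iff mult_vec_swap_cols[OF K])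
  also have "distr (?R \<Otimes>\<^sub>M ?L) borel (?F \<circ> ?s) = distr (distr (?R \<Otimes>\<^sub>M ?L) borel ?s) borel ?F"
    by (rule distr_distr[symmetric, OF F]) (simp only: RL s)
  \<comment> \<open>The swap leaves the noise factor alone, so its image is again a product, with
    the row invariance applying to the first factor.\<close>
  also have "distr (?R \<Otimes>\<^sub>M ?L) borel ?s = distr ?R borel (swap_cols K) \<Otimes>\<^sub>M distr ?L borel (\<lambda>u. u)"
    by (subst pair_measure_distr) (auto simp: L.sigma_finite_measure_axioms distr_id2 borel_prod)
  also have "\<dots> = ?R \<Otimes>\<^sub>M ?L"
    unfolding R by (simp add: distr_id2)
  finally show ?thesis unfolding joint .
qed

section \<open>Control of the false discovery rate\<close>

text \<open>Markov's inequality in counting form: an aggregated p-value at most \<open>u\<close>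
  forces at least \<open>\<gamma> * B\<close> of the draws to have an intermediate p-value at most
  \<open>\<gamma> * u\<close>. Counting pairs of a null and a draw in both orders gives the bound,
  without any assumption on how the draws depend on each other.\<close>

lemma card_aggregated_pval_le:
  fixes w :: "nat \<Rightarrow> real^'p"
  assumes B: "B \<ge> 1" and \<gamma>: "0 < \<gamma>" "\<gamma> \<le> 1" and u: "u < 1"
  shows "real (card {j\<in>N. aggregated_pval \<gamma> B (\<lambda>b. intermediate_pval (w b)) j \<le> u})
    \<le> (\<Sum>b=1..B. real (card (early_pos N (nat \<lfloor>real CARD('p) * (\<gamma> * u)\<rfloor>) (($) (w b))))) / (\<gamma> * real B)"
proof -
  define t where "t = \<gamma> * u"
  define m where "m = nat \<lfloor>real CARD('p) * t\<rfloor>"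
  let ?S = "{j\<in>N. aggregated_pval \<gamma> B (\<lambda>b. intermediate_pval (w b)) j \<le> u}"
  \<comment> \<open>Excludes the default p-value 1 of nonpositive statistics.\<close>
  have t: "t < 1" unfolding t_def using \<gamma> u by (smt (verit) mult_left_le mult_less_cancel_left2 mult_nonneg_nonpos)
  have sel: "{j\<in>N. intermediate_pval v j \<le> t} \<subseteq> early_pos N m (($) v)" for v :: "real^'p"
  proof
    fix j assume j: "j \<in> {j\<in>N. intermediate_pval v j \<le> t}"
    with t have pos: "v $ j > 0" by (auto simp: intermediate_pval_def split: if_splits)
    have "card {k\<in>N. v $ k \<le> - v $ j} \<le> card {k. v $ k \<le> - v $ j}" by (intro card_mono) auto
    moreover from j pos have "1 + real (card {k. v $ k \<le> - v $ j}) \<le> real CARD('p) * t"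
      by (auto simp: intermediate_pval_def field_simps)
    ultimately have "1 + int (card {k\<in>N. v $ k \<le> - v $ j}) \<le> \<lfloor>real CARD('p) * t\<rfloor>"
      by (simp add: le_floor_iff)
    thus "j \<in> early_pos N m (($) v)" using j pos by (auto simp: early_pos_def m_def)
  qed
  have "\<gamma> * real B \<le> (\<Sum>b=1..B. of_bool (intermediate_pval (w b) j \<le> t))" if "j \<in> ?S" for j
  proof -
    \<comment> \<open>As \<open>u < 1\<close>, the truncation at 1 is not what makes the aggregated
      p-value small.\<close>
    have "emp_quantile \<gamma> B (\<lambda>b. intermediate_pval (w b) j) \<le> t"
      using that u \<gamma> by (auto simp: aggregated_pval_def t_def field_simps min_le_iff_disj)
    from emp_quantile_leD[OF B \<gamma>(2) this]
    have "\<gamma> * real B \<le> real (card {b \<in> {1..B}. intermediate_pval (w b) j \<le> t})"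
      using B by (simp add: field_simps)
    also have "\<dots> = (\<Sum>b=1..B. of_bool (intermediate_pval (w b) j \<le> t))"
      by (simp add: of_bool_def sum.If_cases Int_def)
    finally show ?thesis .
  qed
  hence "(\<Sum>j\<in>?S. \<gamma> * real B) \<le> (\<Sum>j\<in>?S. \<Sum>b=1..B. of_bool (intermediate_pval (w b) j \<le> t))"
    by (rule sum_mono)
  also have "\<dots> \<le> (\<Sum>j\<in>N. \<Sum>b=1..B. of_bool (intermediate_pval (w b) j \<le> t))"
    by (intro sum_mono2) (auto intro!: sum_nonneg)
  also have "\<dots> = (\<Sum>b=1..B. \<Sum>j\<in>N. of_bool (intermediate_pval (w b) j \<le> t))"
    by (rule sum.swap)
  also have "\<dots> = (\<Sum>b=1..B. real (card {j\<in>N. intermediate_pval (w b) j \<le> t}))"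
    by (simp add: of_bool_def sum.If_cases Int_def)
  also have "\<dots> \<le> (\<Sum>b=1..B. real (card (early_pos N m (($) (w b)))))"
    using sel by (intro sum_mono of_nat_mono card_mono) (auto simp: early_pos_def)
  finally show ?thesis using B \<gamma> by (simp add: field_simps t_def m_def)
qed

section \<open>Expected counts under sign symmetry\<close>

lemma measurable_card_early_pos:
  fixes I :: "'p::finite set"
  shows "(\<lambda>z::real^'p. real (card (early_pos I m (($) z)))) \<in> borel_measurable borel"
proof -
  have [measurable]: "(\<lambda>z::real^'p. z $ k) \<in> borel_measurable borel" for k
    by (intro borel_measurable_continuous_onI continuous_intros)
  have card: "real (card {k\<in>I. P k}) = (\<Sum>k\<in>I. if P k then 1 else 0)" for P
    by (simp add: sum.If_cases Int_def)
  have "real (card (early_pos I m (($) z))) =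
      (\<Sum>j\<in>I. if z $ j > 0 \<and> (\<Sum>k\<in>I. if z $ k \<le> - z $ j then 1 else 0) < real m then 1 else 0)" for z :: "real^'p"
    unfolding early_pos_def card[symmetric] by simp
  thus ?thesis by simp
qed

text \<open>Averaging over all flips replaces conditioning on the absolute values: each flip leaves
  the expectation unchanged, while the sum over flips is bounded pointwise by the counting
  argument.\<close>

lemma (in prob_space) expectation_early_pos_le:
  fixes Z :: "'a \<Rightarrow> real^'p"
  assumes [measurable]: "Z \<in> borel_measurable M"
    and inv: "\<And>K. K \<subseteq> I \<Longrightarrow> distr M borel (\<lambda>\<omega>. \<chi> j. flip K (($) (Z \<omega>)) j) = distr M borel Z"
  shows "integrable M (\<lambda>\<omega>. real (card (early_pos I m (($) (Z \<omega>)))))"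
    and "expectation (\<lambda>\<omega>. real (card (early_pos I m (($) (Z \<omega>))))) \<le> real m"
proof -
  define g where "g z = real (card (early_pos I m (($) z)))" for z :: "real^'p"
  define T where "T K z = (\<chi> j. flip K (($) z) j)" for K and z :: "real^'p"
  have [measurable]: "g \<in> borel_measurable borel"
    unfolding g_def by (rule measurable_card_early_pos)
  have [measurable]: "T K \<in> borel_measurable borel" for K
  proof -
    have "continuous_on UNIV (\<lambda>z::real^'p. flip K (($) z) j)" for j
      by (cases "j \<in> K") (simp_all add: flip_def continuous_intros)
    thus ?thesis unfolding T_def by (intro borel_measurable_continuous_onI continuous_intros)
  qed
  have g: "0 \<le> g z" "g z \<le> real CARD('p)" for z
    by (auto simp: g_def intro!: card_mono)
  have int: "integrable M (\<lambda>\<omega>. g (T K (Z \<omega>)))" for K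
    by (intro integrable_const_bound[where B = "real CARD('p)"]) (auto simp: g)
  show "integrable M (\<lambda>\<omega>. real (card (early_pos I m (($) (Z \<omega>)))))"
    unfolding g_def[symmetric] by (intro integrable_const_bound[where B = "real CARD('p)"]) (auto simp: g)
  have eq: "expectation (\<lambda>\<omega>. g (T K (Z \<omega>))) = expectation (\<lambda>\<omega>. g (Z \<omega>))" if "K \<in> Pow I" for K
  proof -
    have "expectation (\<lambda>\<omega>. g (T K (Z \<omega>))) = integral\<^sup>L (distr M borel (\<lambda>\<omega>. T K (Z \<omega>))) g"
      by (subst integral_distr) auto
    also have "distr M borel (\<lambda>\<omega>. T K (Z \<omega>)) = distr M borel Z"
      using inv[of K] that by (simp add: T_def)
    also have "integral\<^sup>L \<dots> g = expectation (\<lambda>\<omega>. g (Z \<omega>))"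
      by (subst integral_distr) auto
    finally show ?thesis .
  qed
  have "2 ^ card I * expectation (\<lambda>\<omega>. g (Z \<omega>)) = (\<Sum>K\<in>Pow I. expectation (\<lambda>\<omega>. g (T K (Z \<omega>))))"
    by (simp add: eq card_Pow)
  also have "\<dots> = expectation (\<lambda>\<omega>. \<Sum>K\<in>Pow I. g (T K (Z \<omega>)))"
    by (rule Bochner_Integration.integral_sum[symmetric]) (rule int)
  also have "\<dots> \<le> expectation (\<lambda>\<omega>. real (m * 2 ^ card I))"
  proof (rule integral_mono)
    fix \<omega>
    show "(\<Sum>K\<in>Pow I. g (T K (Z \<omega>))) \<le> real (m * 2 ^ card I)"
      using sum_early_pos_flip_le[of I m "($) (Z \<omega>)"] unfolding g_def T_def
      by (simp flip: of_nat_sum add: vec_lambda_inverse del: of_nat_mult)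
  qed (auto intro!: int)
  also have "\<dots> = 2 ^ card I * real m" by (simp add: prob_space)
  finally show "expectation (\<lambda>\<omega>. real (card (early_pos I m (($) (Z \<omega>))))) \<le> real m"
    by (simp add: g_def)
qed

text \<open>The sign property of \<open>f\<close> turns a column swap into a sign flip, so the
  invariance of the data law under null swaps passes to the statistic.\<close>

lemma (in prob_space) distr_knockoff_statistic_flip:
  fixes X X' :: "'a \<Rightarrow> real^'p^'n" and y \<epsilon> :: "'a \<Rightarrow> real^'n"
  assumes lin: "linear_model M P\<^sub>X X \<beta> \<sigma> \<epsilon> y" and law: "knockoff_law P\<^sub>X Q"
    and km: "knockoff_matrix M Q X y X'" and f: "knockoff_statistic f"
  defines "Z \<equiv> \<lambda>\<omega>. f (X \<omega>, X' \<omega>) (y \<omega>)"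
  shows "Z \<in> borel_measurable M"
    and "K \<subseteq> nulls \<beta> \<Longrightarrow> distr M borel (\<lambda>\<omega>. \<chi> j. flip K (($) (Z \<omega>)) j) = distr M borel Z"
proof -
  let ?F = "\<lambda>(XX, y). f XX y"
  have F: "?F \<in> borel_measurable borel" using f by (simp add: knockoff_statistic_def)
  have [measurable]: "X \<in> borel_measurable M" "X' \<in> borel_measurable M" "y \<in> borel_measurable M"
    using lin km by (auto simp: linear_model_def knockoff_matrix_def intro: linear_model_measurable[OF lin])
  have XY: "(\<lambda>\<omega>. ((X \<omega>, X' \<omega>), y \<omega>)) \<in> borel_measurable M"
    by measurable
  have sXY: "(\<lambda>\<omega>. (swap_cols K (X \<omega>, X' \<omega>), y \<omega>)) \<in> borel_measurable M"
    by measurable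
  show "Z \<in> borel_measurable M"
    unfolding Z_def using measurable_compose[OF XY F] by simp
  assume K: "K \<subseteq> nulls \<beta>"
  have "(\<chi> j. flip K (($) (Z \<omega>)) j) = ?F (swap_cols K (X \<omega>, X' \<omega>), y \<omega>)" for \<omega>
    using f by (simp add: knockoff_statistic_def vec_eq_iff flip_def Z_def)
  hence "distr M borel (\<lambda>\<omega>. \<chi> j. flip K (($) (Z \<omega>)) j) =
    distr (distr M borel (\<lambda>\<omega>. (swap_cols K (X \<omega>, X' \<omega>), y \<omega>))) borel ?F"
    by (subst distr_distr[OF F sXY]) (simp add: comp_def)
  also have "\<dots> = distr M borel Z"
    unfolding distr_knockoff_swap[OF lin law km K]
    by (subst distr_distr[OF F XY]) (simp add: comp_def Z_def)
  finally show "distr M borel (\<lambda>\<omega>. \<chi> j. flip K (($) (Z \<omega>)) j) = distr M borel Z" .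
qed

section \<open>The numerical constant and the final bound\<close>

lemma AKO_constant: "1 \<le> (sqrt 22 - 2) / (7 * sqrt 22 - 32)" "(sqrt 22 - 2) / (7 * sqrt 22 - 32) \<le> (3.24 :: real)"
proof -
  \<comment> \<open>The lower bound makes the denominator positive and suffices for 3.24, which
    amounts to \<open>sqrt 22 \<ge> 101.68 / 21.68\<close>, about 4.69004. The constant is at least
    1 as soon as \<open>sqrt 22 \<le> 5\<close>.\<close>
  have "(4.6904 :: real) \<le> sqrt 22" by (rule real_le_rsqrt) (simp add: power2_eq_square)
  moreover have "sqrt 22 \<le> (4.7 :: real)" by (rule real_le_lsqrt) (simp_all add: power2_eq_square)
  ultimately show "1 \<le> (sqrt 22 - 2) / (7 * sqrt 22 - 32)"
    "(sqrt 22 - 2) / (7 * sqrt 22 - 32) \<le> (3.24 :: real)"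
    by (simp_all add: field_simps)
qed

theorem theorem1:
  fixes M :: "'a measure"
    and P\<^sub>X :: "(real^'p) measure"
    and Q :: "((real^'p) \<times> (real^'p)) measure"
    and P\<^sub>0 :: "real measure"
    and X :: "'a \<Rightarrow> real^'p^'n"
    and X' :: "nat \<Rightarrow> 'a \<Rightarrow> real^'p^'n"
    and \<epsilon> y :: "'a \<Rightarrow> real^'n"
    and \<beta> :: "real^'p"
    and f :: "(real^'p^'n) \<times> (real^'p^'n) \<Rightarrow> real^'n \<Rightarrow> real^'p"
    and W :: "nat \<Rightarrow> 'a \<Rightarrow> real^'p"
    and \<sigma> \<alpha> \<gamma> :: real
    and B :: nat
  assumes "prob_space M"
    and "linear_model M P\<^sub>X X \<beta> \<sigma> \<epsilon> y"
    and "knockoff_law P\<^sub>X Q"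
    and "\<And>b. b \<in> {1..B} \<Longrightarrow> knockoff_matrix M Q X y (X' b)"
    and "knockoff_statistic f"
    and "\<And>b \<omega>. b \<in> {1..B} \<Longrightarrow> \<omega> \<in> space M \<Longrightarrow> W b \<omega> = f (X \<omega>, X' b \<omega>) (y \<omega>)"
    and "\<And>b. b \<in> {1..B} \<Longrightarrow> iid_on M P\<^sub>0 (\<lambda>j \<omega>. W b \<omega> $ j) (nulls \<beta>)"
    and "card (nulls \<beta>) \<ge> 2"
    and "B \<ge> 1"
    and "0 < \<gamma>" "\<gamma> \<le> 1"
    and "0 < \<alpha>" "\<alpha> < 1"
  shows "prob_space.expectation M
           (\<lambda>\<omega>. let S = AKO_BY \<alpha> \<gamma> B (\<lambda>b. W b \<omega>)
                in real (card (S \<inter> nulls \<beta>)) / real (max (card S) 1))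
           \<le> (sqrt 22 - 2) / (7 * sqrt 22 - 32) * \<alpha>
         \<and> (sqrt 22 - 2) / (7 * sqrt 22 - 32) \<le> (3.24 :: real)"
proof -
  interpret prob_space M by fact
  define p where "p = CARD('p)"
  define N where "N = nulls \<beta>"
  define c where "c = BY_factor p * \<alpha> / real p"
  define H where "H = (\<Sum>i=1..p. 1 / real i)"
  define m where "m k = nat \<lfloor>real p * (\<gamma> * (real k * c))\<rfloor>" for k
  \<comment> \<open>\<open>W b\<close> agrees with this expression on \<open>space M\<close> for
    draws in range; \<open>Z\<close> is defined everywhere and carries measurability and sign
    invariance.\<close>
  define Z where "Z b \<omega> = f (X \<omega>, X' b \<omega>) (y \<omega>)" for b \<omega>
  define G where "G \<omega> = (\<Sum>k=1..p. BY_weight p k *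
    ((\<Sum>b=1..B. real (card (early_pos N (m k) (($) (Z b \<omega>))))) / (\<gamma> * real B)))" for \<omega>
  have p: "1 \<le> p" unfolding p_def using card_gt_0_iff[of "UNIV::'p set"] by simp
  have "1 \<le> H"
    unfolding H_def using p by (subst sum.atLeast_Suc_atMost) (auto intro!: sum_nonneg)
  hence H: "0 < H" "BY_factor p = 1 / H" "BY_factor p \<le> 1"
    by (auto simp: BY_factor_def H_def inverse_eq_divide)
  have c0: "0 \<le> c" unfolding c_def using H p \<open>0 < \<alpha>\<close> by simp
  \<comment> \<open>The harmonic sum is at least 1, so every step-up threshold is at most
    \<open>\<alpha> < 1\<close>, as the counting bound requires.\<close>
  have c1: "real k * c < 1" if "k \<in> {1..p}" for k
  proof -
    have "real k * c \<le> real p * c" using that c0 by (intro mult_right_mono) auto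
    also have "\<dots> = BY_factor p * \<alpha>" unfolding c_def using p by simp
    also have "\<dots> \<le> 1 * \<alpha>" using H \<open>0 < \<alpha>\<close> by (intro mult_right_mono) auto
    finally show ?thesis using \<open>\<alpha> < 1\<close> by simp
  qed
  have fdp: "(let S = AKO_BY \<alpha> \<gamma> B (\<lambda>b. W b \<omega>) in real (card (S \<inter> nulls \<beta>)) / real (max (card S) 1)) \<le> G \<omega>"
    if "\<omega> \<in> space M" for \<omega>
  proof -
    let ?a = "aggregated_pval \<gamma> B (\<lambda>b. intermediate_pval (W b \<omega>))"
    have "(let S = AKO_BY \<alpha> \<gamma> B (\<lambda>b. W b \<omega>) in real (card (S \<inter> nulls \<beta>)) / real (max (card S) 1))
      \<le> (\<Sum>k=1..p. BY_weight p k * real (card {j\<in>N. ?a j \<le> real k * c}))"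
      unfolding Let_def AKO_BY_def N_def c_def p_def
      using \<open>0 < \<alpha>\<close> by (intro BY_select_fdp_le) simp
    also have "\<dots> \<le> (\<Sum>k=1..p. BY_weight p k *
      ((\<Sum>b=1..B. real (card (early_pos N (m k) (($) (W b \<omega>))))) / (\<gamma> * real B)))"
      unfolding m_def p_def
      by (intro sum_mono mult_left_mono BY_weight_nonneg card_aggregated_pval_le c1[unfolded p_def]
        \<open>B \<ge> 1\<close> \<open>0 < \<gamma>\<close> \<open>\<gamma> \<le> 1\<close>)
    also have "\<dots> = G \<omega>"
      unfolding G_def Z_def using that assms(6) by simp
    finally show ?thesis .
  qed
  have Z: "integrable M (\<lambda>\<omega>. real (card (early_pos N i (($) (Z b \<omega>)))))"
    "expectation (\<lambda>\<omega>. real (card (early_pos N i (($) (Z b \<omega>))))) \<le> real i" if "b \<in> {1..B}" for b i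
    using distr_knockoff_statistic_flip[OF assms(2,3) assms(4)[OF that] assms(5)]
    unfolding N_def Z_def by (intro expectation_early_pos_le; simp)+
  have "expectation (\<lambda>\<omega>. let S = AKO_BY \<alpha> \<gamma> B (\<lambda>b. W b \<omega>)
      in real (card (S \<inter> nulls \<beta>)) / real (max (card S) 1)) \<le> expectation G"
  \<comment> \<open>Only the dominating \<open>G\<close> has to be shown integrable. If the false
    discovery proportion were not, its integral would be 0 by default, which is why \<open>G\<close>
    must be nonnegative.\<close>
  proof (rule integral_mono')
    show "integrable M G" unfolding G_def
      by (intro Bochner_Integration.integrable_sum integrable_mult_right integrable_divide Z)
    show "0 \<le> G \<omega>" for \<omega>
      unfolding G_def using \<open>0 < \<gamma>\<close>
      by (intro sum_nonneg mult_nonneg_nonneg divide_nonneg_nonneg BY_weight_nonneg) auto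
  qed (rule fdp)
  also have "expectation G = (\<Sum>k=1..p. BY_weight p k *
    ((\<Sum>b=1..B. expectation (\<lambda>\<omega>. real (card (early_pos N (m k) (($) (Z b \<omega>)))))) / (\<gamma> * real B)))"
    unfolding G_def
    by (subst Bochner_Integration.integral_sum)
      (auto simp: Bochner_Integration.integral_sum Z
        intro!: Bochner_Integration.integrable_sum integrable_mult_right integrable_divide)
  also have "\<dots> \<le> (\<Sum>k=1..p. BY_weight p k * ((\<Sum>b=1..B. real p * (\<gamma> * (real k * c))) / (\<gamma> * real B)))"
  proof (intro sum_mono mult_left_mono divide_right_mono BY_weight_nonneg)
    \<comment> \<open>The argument of the floor is nonnegative, so \<open>nat\<close> does not
      truncate and rounding down can only decrease it.\<close>
    fix k b assume "b \<in> {1..B}"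
    have "0 \<le> real p * (\<gamma> * (real k * c))" using c0 \<open>0 < \<gamma>\<close> by simp
    hence "real (m k) \<le> real p * (\<gamma> * (real k * c))" unfolding m_def by (simp add: of_nat_nat)
    with Z(2)[OF \<open>b \<in> {1..B}\<close>, of "m k"]
    show "expectation (\<lambda>\<omega>. real (card (early_pos N (m k) (($) (Z b \<omega>))))) \<le> real p * (\<gamma> * (real k * c))" by linarith
  qed (use \<open>0 < \<gamma>\<close> in simp)
  \<comment> \<open>The factor \<open>\<gamma>\<close> in the threshold cancels the one from
    Markov's inequality, and the \<open>B\<close> identical summands cancel the division by
    \<open>B\<close>.\<close>
  also have "\<dots> = (\<Sum>k=1..p. real p * c * (BY_weight p k * real k))"
    using \<open>0 < \<gamma>\<close> \<open>B \<ge> 1\<close> by (intro sum.cong) (auto simp: field_simps)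
  also have "\<dots> = real p * c * H"
    unfolding sum_distrib_left[symmetric] sum_BY_weight_mult[OF p] H_def ..
  also have "\<dots> = \<alpha>" unfolding c_def using H p by simp
  also have "\<alpha> \<le> (sqrt 22 - 2) / (7 * sqrt 22 - 32) * \<alpha>"
    using mult_right_mono[OF AKO_constant(1), of \<alpha>] \<open>0 < \<alpha>\<close> by simp
  finally show ?thesis using AKO_constant(2) by simp
qed

end
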